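(* Let $n\ge 5$, and let $P_1,\dots,P_n$ and $Q_1,\dots,Q_n$ be two $n$-tuples of projections with $P_i,Q_i:\mathbb{P}^k\dashrightarrow\mathbb{P}^{h_i}$, $i=1,\dots,n$. Assume that the associated critical locus $\mathcal{X}\subseteq\mathbb{P}^k$ has the expected dimension $2k-\sum_{i=1}^n h_i$ and has codimension $1$ (so $\sum_{i=1}^n h_i=k+1$). Then $\mathcal{X}$ is either not irreducible or singular.
   Context: We work over $\mathbb{C}$. A projection $P:\mathbb{P}^k\dashrightarrow\mathbb{P}^h$ ($1\le h<k$) is given by an $(h+1)\times(k+1)$ complex matrix of rank $h+1$ (up to a nonzero scalar), also denoted $P$; its center is the linear subspace of $\mathbb{P}^k$, of dimension $k-h-1$, given by the kernel of the matrix. With $\mathbf{X}=(x_0,\dots,x_k)^T$, $Q_i(\mathbf{X})=Q_i\cdot\mathbf{X}$ is a column of $h_i+1$ linear forms. The critical locus $\mathcal{X}$ of the two $n$-tuples is the subscheme of $\mathbb{P}^k$ defined by the ideal generated by the maximal minors (of order $n+k+1$) of the $(n+\sum_{i=1}^n h_i)\times(n+k+1)$ matrix $$M=\begin{pmatrix} P_1 & Q_1(\mathbf{X}) & 0 & \dots & 0\\ P_2 & 0 & Q_2(\mathbf{X}) & \dots & 0\\ \vdots & & & \ddots & \vdots\\ P_n & 0 & 0 & \dots & Q_n(\mathbf{X})\end{pmatrix}.$$ Standing assumptions: the centers of $P_1,\dots,P_n$ have empty common intersection and the centers of $Q_1,\dots,Q_n$ have empty common intersection. "Singular" means not smooth as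 a scheme over $\mathbb{C}$. *)

theory Defs
  imports
    "HOL-Library.Poly_Mapping"
    "HOL-Library.Extended_Real"
    "HOL-Algebra.Ideal"
    "Jordan_Normal_Form.Determinant"
    "Jordan_Normal_Form.DL_Rank"
    "Jordan_Normal_Form.DL_Submatrix"
begin

section \<open>The homogeneous coordinate ring of projective k-space\<close>

text \<open>A polynomial is a finitely supported map from exponent vectors to coefficients; its product
  is the convolution product of \<^theory>\<open>HOL-Library.Poly_Mapping\<close>.\<close>

type_synonym cpoly = "(nat \<Rightarrow>\<^sub>0 nat) \<Rightarrow>\<^sub>0 complex"

definition Const :: "complex \<Rightarrow> cpoly" where
  "Const c = Poly_Mapping.single 0 c"

definition Var :: "nat \<Rightarrow> cpoly" where
  "Var j = Poly_Mapping.single (Poly_Mapping.single j 1) 1"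

definition poly_eval :: "complex vec \<Rightarrow> cpoly \<Rightarrow> complex" where
  "poly_eval v f = (\<Sum>m\<in>Poly_Mapping.keys f.
     Poly_Mapping.lookup f m * (\<Prod>i\<in>Poly_Mapping.keys m. v $ i ^ Poly_Mapping.lookup m i))"

definition partial_deriv :: "nat \<Rightarrow> cpoly \<Rightarrow> cpoly" where
  "partial_deriv j f = (\<Sum>m\<in>Poly_Mapping.keys f.
     Poly_Mapping.single (m - Poly_Mapping.single j 1)
       (of_nat (Poly_Mapping.lookup m j) * Poly_Mapping.lookup f m))"

text \<open>The ring \<open>\<complex>[x\<^sub>0, \<dots>, x\<^sub>k]\<close>.\<close>

definition coord_polys :: "nat \<Rightarrow> cpoly set" where
  "coord_polys k = {f. \<forall>m\<in>Poly_Mapping.keys f. Poly_Mapping.keys m \<subseteq> {..k}}"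

definition coord_ring :: "nat \<Rightarrow> cpoly ring" where
  "coord_ring k = \<lparr>carrier = coord_polys k, monoid.mult = (*), one = 1, zero = 0, add = (+)\<rparr>"

definition homogeneous :: "nat \<Rightarrow> cpoly \<Rightarrow> bool" where
  "homogeneous d f \<longleftrightarrow> (\<forall>m\<in>Poly_Mapping.keys f.
     (\<Sum>i\<in>Poly_Mapping.keys m. Poly_Mapping.lookup m i) = d)"

lemma cring_coord_ring: "cring (coord_ring k)"
proof -
  have add: "f + g \<in> coord_polys k" if "f \<in> coord_polys k" "g \<in> coord_polys k" for f g
    using that keys_add[of f g] by (auto simp: coord_polys_def)
  have mult: "f * g \<in> coord_polys k" if "f \<in> coord_polys k" "g \<in> coord_polys k" for f g
  proof -
    have "Poly_Mapping.keys m \<subseteq> {..k}" if m_in: "m \<in> Poly_Mapping.keys (f * g)" for m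
    proof -
      obtain a b where m: "m = a + b" "a \<in> Poly_Mapping.keys f" "b \<in> Poly_Mapping.keys g"
        using m_in keys_mult[of f g] by blast
      then show ?thesis
        using \<open>f \<in> coord_polys k\<close> \<open>g \<in> coord_polys k\<close> keys_add[of a b]
        by (fastforce simp: coord_polys_def)
    qed
    then show ?thesis by (simp add: coord_polys_def)
  qed
  have uminus: "- f \<in> coord_polys k" if "f \<in> coord_polys k" for f
    using that by (simp add: coord_polys_def keys_minus)
  have "0 \<in> coord_polys k" "1 \<in> coord_polys k"
    by (auto simp: coord_polys_def)
  with add mult uminus show ?thesis
    by (intro cringI abelian_groupI comm_monoidI)
       (auto simp: coord_ring_def algebra_simps intro!: bexI[where x = "- x" for x])
qed


section \<open>Closed subschemes of projective k-space\<close>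

text \<open>A (closed) point of \<open>\<P>\<^sup>k\<close> is given by a nonzero vector of homogeneous coordinates, and a set
  of points by the set of all the coordinate vectors of its points. All the sets occurring below
  are invariant under nonzero scalars, so inclusions and unions are those of subsets of \<open>\<P>\<^sup>k\<close>.\<close>

definition proj_points :: "nat \<Rightarrow> complex vec set" where
  "proj_points k = {v \<in> carrier_vec (k + 1). v \<noteq> 0\<^sub>v (k + 1)}"

definition zero_locus :: "nat \<Rightarrow> cpoly set \<Rightarrow> complex vec set" where
  "zero_locus k F = {v \<in> proj_points k. \<forall>f\<in>F. poly_eval v f = 0}"

definition zariski_closed :: "nat \<Rightarrow> complex vec set \<Rightarrow> bool" where
  "zariski_closed k Z \<longleftrightarrow>
     (\<exists>F \<subseteq> coord_polys k. (\<forall>f\<in>F. \<exists>d. homogeneous d f) \<and> Z = zero_locus k F)"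

definition irreducible_closed :: "nat \<Rightarrow> complex vec set \<Rightarrow> bool" where
  "irreducible_closed k Z \<longleftrightarrow> zariski_closed k Z \<and> Z \<noteq> {} \<and>
     (\<forall>A B. zariski_closed k A \<longrightarrow> zariski_closed k B \<longrightarrow> Z \<subseteq> A \<union> B \<longrightarrow> Z \<subseteq> A \<or> Z \<subseteq> B)"

text \<open>Krull dimension, as a supremum of lengths of chains \<open>C 0 \<subset> \<dots> \<subset> C l\<close> of irreducible closed
  subsets; it takes values in \<^typ>\<open>ereal\<close>, so that the empty set has dimension \<open>-\<infinity>\<close>. Chains all of
  whose members contain \<open>p\<close> give the dimension at \<open>p\<close>, i.e. the dimension of the local ring there.\<close>

definition irreducible_chain :: "nat \<Rightarrow> complex vec set \<Rightarrow> nat \<Rightarrow> (nat \<Rightarrow> complex vec set) \<Rightarrow> bool" where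
  "irreducible_chain k Z l C \<longleftrightarrow>
     (\<forall>i\<le>l. irreducible_closed k (C i) \<and> C i \<subseteq> Z) \<and> (\<forall>i<l. C i \<subset> C (Suc i))"

definition krull_dim :: "nat \<Rightarrow> complex vec set \<Rightarrow> ereal" where
  "krull_dim k Z = Sup {ereal (real l) | l. \<exists>C. irreducible_chain k Z l C}"

definition krull_dim_at :: "nat \<Rightarrow> complex vec set \<Rightarrow> complex vec \<Rightarrow> ereal" where
  "krull_dim_at k Z p =
     Sup {ereal (real l) | l. \<exists>C. irreducible_chain k Z l C \<and> (\<forall>i\<le>l. p \<in> C i)}"

text \<open>In the following, \<open>I\<close> is a homogeneous ideal of \<^term>\<open>coord_ring k\<close>, standing for the closed
  subscheme \<open>X = Proj (\<complex>[x\<^sub>0, \<dots>, x\<^sub>k] / I)\<close> of \<open>\<P>\<^sup>k\<close>.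

  The tangent space at a coordinate vector \<open>p\<close> of the affine cone over \<open>X\<close> contains the line
  spanned by \<open>p\<close> by Euler's relation, and its quotient by this line is, up to a twist, the Zariski
  tangent space of \<open>X\<close> at \<open>p\<close>, dual to the fibre of the sheaf of differentials. As \<open>X\<close> is of finite
  type over \<open>\<complex>\<close>, it is smooth at a closed point iff this fibre has the dimension of \<open>X\<close> at the
  point, and it is smooth iff it is smooth at all closed points.\<close>

definition cone_tangent_space :: "nat \<Rightarrow> cpoly set \<Rightarrow> complex vec \<Rightarrow> complex vec set" where
  "cone_tangent_space k I p =
     {w \<in> carrier_vec (k + 1). \<forall>f\<in>I. (\<Sum>j\<le>k. poly_eval p (partial_deriv j f) * w $ j) = 0}"

definition tangent_dim :: "nat \<Rightarrow> cpoly set \<Rightarrow> complex vec \<Rightarrow> ereal" where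
  "tangent_dim k I p = ereal (real (vectorspace.dim class_ring
     (module_vec TYPE(complex) (k + 1) \<lparr>carrier := cone_tangent_space k I p\<rparr>)) - 1)"

definition smooth_scheme :: "nat \<Rightarrow> cpoly set \<Rightarrow> bool" where
  "smooth_scheme k I \<longleftrightarrow>
     (\<forall>p\<in>zero_locus k I. tangent_dim k I p = krull_dim_at k (zero_locus k I) p)"

definition singular_scheme :: "nat \<Rightarrow> cpoly set \<Rightarrow> bool" where
  "singular_scheme k I \<longleftrightarrow> \<not> smooth_scheme k I"

definition irreducible_scheme :: "nat \<Rightarrow> cpoly set \<Rightarrow> bool" where
  "irreducible_scheme k I \<longleftrightarrow> irreducible_closed k (zero_locus k I)"

definition scheme_dim :: "nat \<Rightarrow> cpoly set \<Rightarrow> ereal" where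
  "scheme_dim k I = krull_dim k (zero_locus k I)"

text \<open>As \<open>\<P>\<^sup>k\<close> is irreducible of dimension \<open>k\<close> and catenary, the codimension in it is \<open>k - dim X\<close>.\<close>

definition scheme_codim :: "nat \<Rightarrow> cpoly set \<Rightarrow> ereal" where
  "scheme_codim k I = ereal (real k) - scheme_dim k I"


section \<open>Projections and their critical locus\<close>

definition projection :: "nat \<Rightarrow> nat \<Rightarrow> complex mat \<Rightarrow> bool" where
  "projection k h P \<longleftrightarrow>
     1 \<le> h \<and> h < k \<and> P \<in> carrier_mat (h + 1) (k + 1) \<and> vec_space.rank (h + 1) P = h + 1"

definition center :: "nat \<Rightarrow> complex mat \<Rightarrow> complex vec set" where
  "center k P = {v \<in> proj_points k. P *\<^sub>v v = 0\<^sub>v (dim_row P)}"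

definition linear_forms :: "nat \<Rightarrow> complex mat \<Rightarrow> cpoly vec" where
  "linear_forms k Q = map_mat Const Q *\<^sub>v vec (k + 1) Var"

text \<open>The \<open>n\<close>-tuples are indexed by \<open>0, \<dots>, n - 1\<close>. The \<open>i\<close>-th block of rows of the matrix \<open>M\<close> has
  \<open>h i + 1\<close> rows and starts at row \<open>row_offset h i\<close>; \<open>row_block h r\<close> is the block containing
  row \<open>r\<close>.\<close>

definition row_offset :: "(nat \<Rightarrow> nat) \<Rightarrow> nat \<Rightarrow> nat" where
  "row_offset h i = (\<Sum>j<i. (h j + 1))"

definition row_block :: "(nat \<Rightarrow> nat) \<Rightarrow> nat \<Rightarrow> nat" where
  "row_block h r = (LEAST i. r < row_offset h (Suc i))"

definition critical_matrix ::
  "nat \<Rightarrow> nat \<Rightarrow> (nat \<Rightarrow> nat) \<Rightarrow> (nat \<Rightarrow> complex mat) \<Rightarrow> (nat \<Rightarrow> complex mat) \<Rightarrow> cpoly mat" where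
  "critical_matrix n k h P Q = mat (n + (\<Sum>i<n. h i)) (n + k + 1) (\<lambda>(r, c).
     let i = row_block h r; s = r - row_offset h i in
       if c \<le> k then Const (P i $$ (s, c))
       else if c = k + 1 + i then linear_forms k (Q i) $ s
       else 0)"

definition maximal_minors :: "cpoly mat \<Rightarrow> cpoly set" where
  "maximal_minors M =
     {det (submatrix M R UNIV) | R. R \<subseteq> {..<dim_row M} \<and> card R = dim_col M}"

definition critical_ideal ::
  "nat \<Rightarrow> nat \<Rightarrow> (nat \<Rightarrow> nat) \<Rightarrow> (nat \<Rightarrow> complex mat) \<Rightarrow> (nat \<Rightarrow> complex mat) \<Rightarrow> cpoly set" where
  "critical_ideal n k h P Q =
     genideal (coord_ring k) (maximal_minors (critical_matrix n k h P Q))"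

end

theory Submission
  imports Defs
begin

text \<open>Since \<open>h 0 + \<dots> + h (n - 1) = k + 1\<close> and \<open>n \<ge> 5\<close>, the two blocks \<open>Q 0\<close> and \<open>Q 1\<close> have
  together at most \<open>k\<close> rows, so their centers share a point \<open>x\<close>. There two columns of the critical
  matrix vanish, and every term of the Leibniz expansion of a maximal minor has two factors
  vanishing at \<open>x\<close>. So all first derivatives of the equations of the critical locus vanish
  at \<open>x\<close>: its tangent space there has dimension \<open>k\<close>, while the locus has dimension \<open>k - 1\<close>.\<close>

section \<open>Evaluation and differentiation\<close>

text \<open>A polynomial is a finite sum of monomial terms, so identities that are additive in each
  argument need only be checked on \<open>Poly_Mapping.single\<close>.\<close>

lemma cpoly_induct [case_names zero single add]:
  fixes f :: cpoly
  assumes "P 0" "\<And>m c. P (Poly_Mapping.single m c)" "\<And>f g. P f \<Longrightarrow> P g \<Longrightarrow> P (f + g)"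
  shows "P f"
proof (induction f rule: Poly_Mapping.update_induct)
  case const
  show ?case by fact
next
  case (update f m c)
  \<comment> \<open>The key \<open>m\<close> is new to \<open>f\<close>, so overwriting its
    coefficient 0 by \<open>c\<close> amounts to adding a term.\<close>
  have "Poly_Mapping.update m c f = f + Poly_Mapping.single m c"
    using update.hyps(1)
    by (intro poly_mapping_eqI) (auto simp: lookup_update lookup_add lookup_single when_def in_keys_iff)
  then show ?case using assms update by simp
qed

definition monom_eval :: "complex vec \<Rightarrow> (nat \<Rightarrow>\<^sub>0 nat) \<Rightarrow> complex" where
  "monom_eval v m = (\<Prod>i\<in>Poly_Mapping.keys m. v $ i ^ Poly_Mapping.lookup m i)"

text \<open>Outside the support the exponent is 0 and the extra factors are 1, even where
  \<open>v $ i\<close> is 0. This lets monomials with different supports share one index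
  set.\<close>

lemma monom_eval_superset:
  assumes "finite S" "Poly_Mapping.keys m \<subseteq> S"
  shows "monom_eval v m = (\<Prod>i\<in>S. v $ i ^ Poly_Mapping.lookup m i)"
  unfolding monom_eval_def using assms by (intro prod.mono_neutral_left) (auto simp: in_keys_iff)

lemma monom_eval_add: "monom_eval v (a + b) = monom_eval v a * monom_eval v b"
proof -
  let ?S = "Poly_Mapping.keys a \<union> Poly_Mapping.keys b"
  have "monom_eval v m = (\<Prod>i\<in>?S. v $ i ^ Poly_Mapping.lookup m i)" if "m \<in> {a, b, a + b}" for m
    using that keys_add[of a b] by (intro monom_eval_superset) auto
  then show ?thesis by (simp add: lookup_add power_add prod.distrib)
qed

lemma sum_keys_superset:
  fixes F :: "'a \<Rightarrow> 'b::zero \<Rightarrow> 'c::comm_monoid_add"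
  assumes "finite S" "Poly_Mapping.keys f \<subseteq> S" "\<And>m. F m 0 = 0"
  shows "(\<Sum>m\<in>Poly_Mapping.keys f. F m (Poly_Mapping.lookup f m)) =
    (\<Sum>m\<in>S. F m (Poly_Mapping.lookup f m))"
  using assms by (intro sum.mono_neutral_left) (auto simp: in_keys_iff)

text \<open>Cancellation can make the support of \<open>f + g\<close> smaller than the union of the
  two supports. Since \<open>F m 0 = 0\<close>, all three sums extend to that union, where
  additivity applies termwise. Evaluation and differentiation are both instances.\<close>

lemma sum_keys_add:
  fixes F :: "'a \<Rightarrow> 'b::monoid_add \<Rightarrow> 'c::comm_monoid_add"
  assumes zero: "\<And>m. F m 0 = 0" and add: "\<And>m a b. F m (a + b) = F m a + F m b"
  shows "(\<Sum>m\<in>Poly_Mapping.keys (f + g). F m (Poly_Mapping.lookup (f + g) m)) =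
    (\<Sum>m\<in>Poly_Mapping.keys f. F m (Poly_Mapping.lookup f m)) +
    (\<Sum>m\<in>Poly_Mapping.keys g. F m (Poly_Mapping.lookup g m))"
proof -
  let ?S = "Poly_Mapping.keys f \<union> Poly_Mapping.keys g"
  have "(\<Sum>m\<in>Poly_Mapping.keys p. F m (Poly_Mapping.lookup p m)) =
      (\<Sum>m\<in>?S. F m (Poly_Mapping.lookup p m))" if "p \<in> {f, g, f + g}" for p
    using that keys_add[of f g] zero by (intro sum_keys_superset) auto
  from this[of f] this[of g] this[of "f + g"] show ?thesis
    by (simp add: lookup_add add sum.distrib)
qed

lemma poly_eval_altdef:
  "poly_eval v f = (\<Sum>m\<in>Poly_Mapping.keys f. Poly_Mapping.lookup f m * monom_eval v m)"
  by (simp add: poly_eval_def monom_eval_def)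

lemma poly_eval_add: "poly_eval v (f + g) = poly_eval v f + poly_eval v g"
  unfolding poly_eval_altdef by (rule sum_keys_add) (auto simp: algebra_simps)

lemma poly_eval_single: "poly_eval v (Poly_Mapping.single m c) = c * monom_eval v m"
  by (cases "c = 0") (auto simp: poly_eval_altdef)

lemma poly_eval_0: "poly_eval v 0 = 0"
  by (simp add: poly_eval_def)

lemma poly_eval_mult: "poly_eval v (f * g) = poly_eval v f * poly_eval v g"
proof (induction f rule: cpoly_induct)
  case (single m c)
  show ?case
  proof (induction g rule: cpoly_induct)
    case (single m' c')
    then show ?case by (simp add: mult_single poly_eval_single monom_eval_add)
  qed (simp_all add: poly_eval_0 poly_eval_add algebra_simps)
qed (simp_all add: poly_eval_0 poly_eval_add algebra_simps)

lemma poly_eval_Const: "poly_eval v (Const c) = c"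
  by (simp add: Const_def poly_eval_single monom_eval_def)

lemma poly_eval_Var: "poly_eval v (Var j) = v $ j"
  by (simp add: Var_def poly_eval_single monom_eval_def)

lemma poly_eval_sum: "poly_eval v (\<Sum>a\<in>A. f a) = (\<Sum>a\<in>A. poly_eval v (f a))"
  by (induction A rule: infinite_finite_induct) (simp_all add: poly_eval_0 poly_eval_add)

section \<open>Formal partial derivatives and the Leibniz rule\<close>

lemma partial_deriv_0: "partial_deriv j 0 = 0"
  by (simp add: partial_deriv_def)

lemma partial_deriv_add: "partial_deriv j (f + g) = partial_deriv j f + partial_deriv j g"
  unfolding partial_deriv_def
  by (rule sum_keys_add[where F = "\<lambda>m c. Poly_Mapping.single (m - Poly_Mapping.single j 1)
        (of_nat (Poly_Mapping.lookup m j) * c)"]) (auto simp: algebra_simps single_add)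

lemma partial_deriv_single:
  "partial_deriv j (Poly_Mapping.single m c) =
     Poly_Mapping.single (m - Poly_Mapping.single j 1) (of_nat (Poly_Mapping.lookup m j) * c)"
  by (cases "c = 0") (auto simp: partial_deriv_def)

text \<open>Subtraction of exponents is truncated, so lowering the exponent of \<open>j\<close>
  commutes with adding \<open>m\<close> only if \<open>m'\<close> contains \<open>j\<close>.
  Otherwise the coefficient is 0 and both sides vanish.\<close>

lemma single_mult_partial_deriv:
  "Poly_Mapping.single m c * partial_deriv j (Poly_Mapping.single m' c') =
     Poly_Mapping.single (m + m' - Poly_Mapping.single j 1) (of_nat (Poly_Mapping.lookup m' j) * c * c')"
proof (cases "Poly_Mapping.lookup m' j = 0")
  case False
  then have "m + (m' - Poly_Mapping.single j 1) = m + m' - Poly_Mapping.single j 1"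
    by (intro poly_mapping_eqI) (auto simp: lookup_add lookup_minus lookup_single when_def)
  then show ?thesis by (simp add: partial_deriv_single mult_single mult_ac)
qed (simp add: partial_deriv_single)

text \<open>Both sides are biadditive, so two nested inductions reduce the rule to monomials; there
  it says that the exponents of \<open>j\<close> in the two factors add up.\<close>

lemma partial_deriv_mult:
  "partial_deriv j (f * g) = f * partial_deriv j g + g * partial_deriv j f"
proof (induction f rule: cpoly_induct)
  case (single m c)
  show ?case
  proof (induction g rule: cpoly_induct)
    case (single m' c')
    have "partial_deriv j (Poly_Mapping.single m c * Poly_Mapping.single m' c') =
        Poly_Mapping.single (m + m' - Poly_Mapping.single j 1)
          (of_nat (Poly_Mapping.lookup m' j) * c * c' + of_nat (Poly_Mapping.lookup m j) * c' * c)"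
      unfolding mult_single partial_deriv_single lookup_add
      by (simp add: algebra_simps)
    then show ?case
      by (simp only: single_mult_partial_deriv single_add add.commute[of m' m])
  next
    case (add f g)
    then show ?case by (simp only: distrib_left distrib_right partial_deriv_add) (simp add: add_ac)
  qed (simp add: partial_deriv_0)
next
  case (add f f')
  then show ?case by (simp only: distrib_left distrib_right partial_deriv_add) (simp add: add_ac)
qed (simp add: partial_deriv_0)


section \<open>Polynomials vanishing to second order at a point\<close>

lemma coord_polys_add: "f \<in> coord_polys k \<Longrightarrow> g \<in> coord_polys k \<Longrightarrow> f + g \<in> coord_polys k"
  using cring.cring_simprules(1)[OF cring_coord_ring, of f k g] by (simp add: coord_ring_def)

lemma coord_polys_mult: "f \<in> coord_polys k \<Longrightarrow> g \<in> coord_polys k \<Longrightarrow> f * g \<in> coord_polys k"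
  using cring.cring_simprules(5)[OF cring_coord_ring, of f k g] by (simp add: coord_ring_def)

lemma coord_polys_uminus: "f \<in> coord_polys k \<Longrightarrow> - f \<in> coord_polys k"
  by (simp add: coord_polys_def keys_minus)

lemma coord_polys_0: "0 \<in> coord_polys k" and coord_polys_1: "1 \<in> coord_polys k"
  by (auto simp: coord_polys_def)

lemma coord_polys_Const: "Const c \<in> coord_polys k"
  by (auto simp: coord_polys_def Const_def)

lemma coord_polys_Var: "j \<le> k \<Longrightarrow> Var j \<in> coord_polys k"
  by (auto simp: coord_polys_def Var_def)

lemma coord_polys_sum: "(\<And>a. a \<in> A \<Longrightarrow> f a \<in> coord_polys k) \<Longrightarrow> (\<Sum>a\<in>A. f a) \<in> coord_polys k"
  by (induction A rule: infinite_finite_induct) (auto simp: coord_polys_0 coord_polys_add)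

lemma coord_polys_prod: "(\<And>a. a \<in> A \<Longrightarrow> f a \<in> coord_polys k) \<Longrightarrow> (\<Prod>a\<in>A. f a) \<in> coord_polys k"
  by (induction A rule: infinite_finite_induct) (auto simp: coord_polys_1 coord_polys_mult)

text \<open>By Taylor expansion this is the square of the maximal ideal of the affine point
  \<open>v\<close>. Indices \<open>j > k\<close> add no condition, since those derivatives of
  elements of \<open>coord_polys k\<close> are 0.\<close>

definition double_zero_ideal :: "nat \<Rightarrow> complex vec \<Rightarrow> cpoly set" where
  "double_zero_ideal k v =
     {f \<in> coord_polys k. poly_eval v f = 0 \<and> (\<forall>j. poly_eval v (partial_deriv j f) = 0)}"

lemma double_zero_ideal_0: "0 \<in> double_zero_ideal k v"
  by (simp add: double_zero_ideal_def coord_polys_0 poly_eval_0 partial_deriv_0)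

lemma double_zero_ideal_add:
  "f \<in> double_zero_ideal k v \<Longrightarrow> g \<in> double_zero_ideal k v \<Longrightarrow> f + g \<in> double_zero_ideal k v"
  by (simp add: double_zero_ideal_def coord_polys_add poly_eval_add partial_deriv_add)

lemma double_zero_ideal_mult:
  "f \<in> double_zero_ideal k v \<Longrightarrow> g \<in> coord_polys k \<Longrightarrow> g * f \<in> double_zero_ideal k v"
  by (simp add: double_zero_ideal_def coord_polys_mult poly_eval_mult partial_deriv_mult poly_eval_add)

lemma double_zero_ideal_sum:
  "(\<And>a. a \<in> A \<Longrightarrow> f a \<in> double_zero_ideal k v) \<Longrightarrow> (\<Sum>a\<in>A. f a) \<in> double_zero_ideal k v"
  by (induction A rule: infinite_finite_induct) (auto simp: double_zero_ideal_0 double_zero_ideal_add)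

text \<open>By the Leibniz rule each term of a derivative of \<open>f * g\<close> keeps one of the
  two factors undifferentiated, and that factor vanishes at \<open>v\<close>.\<close>

lemma mult_in_double_zero_ideal:
  assumes "f \<in> coord_polys k" "g \<in> coord_polys k" "poly_eval v f = 0" "poly_eval v g = 0"
  shows "f * g \<in> double_zero_ideal k v"
  using assms
  by (simp add: double_zero_ideal_def coord_polys_mult poly_eval_mult partial_deriv_mult poly_eval_add)

text \<open>The ideal property is what carries second-order vanishing from the maximal minors to the
  whole ideal that they generate.\<close>

lemma ideal_double_zero_ideal: "ideal (double_zero_ideal k v) (coord_ring k)"
proof (rule idealI)
  let ?J = "double_zero_ideal k v"
  interpret R: cring "coord_ring k" by (rule cring_coord_ring)
  show "ring (coord_ring k)" by (rule R.ring_axioms)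
  have J_sub: "?J \<subseteq> coord_polys k" by (auto simp: double_zero_ideal_def)
  show "subgroup ?J (add_monoid (coord_ring k))"
  proof (rule R.add.subgroupI)
    fix f assume f: "f \<in> ?J"
    have "- f \<in> ?J"
      using double_zero_ideal_mult[OF f coord_polys_uminus[OF coord_polys_1]] by simp
    moreover have "\<ominus>\<^bsub>coord_ring k\<^esub> f = - f"
      using f J_sub coord_polys_uminus
      by (intro R.minus_equality) (auto simp: coord_ring_def)
    ultimately show "\<ominus>\<^bsub>coord_ring k\<^esub> f \<in> ?J"
      by simp
  qed (use J_sub double_zero_ideal_0 in \<open>auto simp: coord_ring_def double_zero_ideal_add\<close>)
  fix f g assume fg: "f \<in> ?J" "g \<in> carrier (coord_ring k)"
  then have "g * f \<in> ?J" by (simp add: coord_ring_def double_zero_ideal_mult)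
  then show "g \<otimes>\<^bsub>coord_ring k\<^esub> f \<in> ?J" "f \<otimes>\<^bsub>coord_ring k\<^esub> g \<in> ?J"
    by (simp_all add: coord_ring_def mult.commute[of f g])
qed

section \<open>Determinants with two columns vanishing at a point\<close>

lemma det_in_double_zero_ideal:
  assumes M: "M \<in> carrier_mat N N"
    and entries: "\<And>i j. i < N \<Longrightarrow> j < N \<Longrightarrow> M $$ (i, j) \<in> coord_polys k"
    and c: "c < N" "c' < N" "c \<noteq> c'"
    and zero: "\<And>i. i < N \<Longrightarrow> poly_eval v (M $$ (i, c)) = 0" "\<And>i. i < N \<Longrightarrow> poly_eval v (M $$ (i, c')) = 0"
  shows "det M \<in> double_zero_ideal k v"
  unfolding det_def'[OF M]
proof (intro double_zero_ideal_sum double_zero_ideal_mult)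
  fix p assume "p \<in> {p. p permutes {0..<N}}"
  then have p: "p permutes {0..<N}" by simp
  show "signof p \<in> coord_polys k"
    by (auto simp: sign_def coord_polys_1 coord_polys_uminus)
  \<comment> \<open>A permutation meets every column, so this Leibniz term has a factor from column
    \<open>c\<close> and one from \<open>c'\<close>. Their rows differ because
    \<open>c \<noteq> c'\<close>, hence both factors can be split off.\<close>
  have "c \<in> p ` {0..<N}" "c' \<in> p ` {0..<N}"
    using c by (simp_all add: permutes_image[OF p])
  then obtain i i' where i: "p i = c" "p i' = c'" "i < N" "i' < N" by auto
  let ?f = "\<lambda>i. M $$ (i, p i)"
  have f: "?f j \<in> coord_polys k" if "j < N" for j
    using entries that permutes_in_image[OF p, of j] by auto
  have "(\<Prod>j = 0..<N. ?f j) = ?f i * prod ?f ({0..<N} - {i})"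
    using i by (intro prod.remove) auto
  also have "prod ?f ({0..<N} - {i}) = ?f i' * prod ?f ({0..<N} - {i} - {i'})"
    using i c by (intro prod.remove) auto
  finally have eq: "(\<Prod>j = 0..<N. ?f j) = prod ?f ({0..<N} - {i} - {i'}) * (?f i * ?f i')"
    by (simp add: mult_ac)
  show "(\<Prod>j = 0..<N. ?f j) \<in> double_zero_ideal k v"
    unfolding eq
  proof (rule double_zero_ideal_mult[OF mult_in_double_zero_ideal coord_polys_prod])
    show "poly_eval v (?f i) = 0" "poly_eval v (?f i') = 0"
      using zero i by simp_all
  qed (use f i in auto)
qed

text \<open>A maximal minor selects rows but keeps all columns, so the two vanishing columns retain
  their indices \<open>c\<close> and \<open>c'\<close> in every submatrix.\<close>

lemma maximal_minors_double_zero: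
  assumes entries: "\<And>i j. i < dim_row M \<Longrightarrow> j < dim_col M \<Longrightarrow> M $$ (i, j) \<in> coord_polys k"
    and c: "c < dim_col M" "c' < dim_col M" "c \<noteq> c'"
    and zero: "\<And>i. i < dim_row M \<Longrightarrow> poly_eval v (M $$ (i, c)) = 0"
      "\<And>i. i < dim_row M \<Longrightarrow> poly_eval v (M $$ (i, c')) = 0"
  shows "maximal_minors M \<subseteq> double_zero_ideal k v"
proof -
  have "det (submatrix M R UNIV) \<in> double_zero_ideal k v"
    if R: "R \<subseteq> {..<dim_row M}" "card R = dim_col M" for R
  proof (rule det_in_double_zero_ideal[OF _ _ c])
    have rows: "{i. i < dim_row M \<and> i \<in> R} = R" using R(1) by auto
    show "submatrix M R UNIV \<in> carrier_mat (dim_col M) (dim_col M)"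
      using R rows by (auto simp: dim_submatrix)
    have pick: "pick R i < dim_row M" if "i < dim_col M" for i
      using pick_in_set_le[of i R] that R by auto
    have index: "submatrix M R UNIV $$ (i, j) = M $$ (pick R i, j)"
      if "i < dim_col M" "j < dim_col M" for i j
      using that R rows by (simp add: submatrix_index pick_UNIV)
    show "submatrix M R UNIV $$ (i, j) \<in> coord_polys k" if "i < dim_col M" "j < dim_col M" for i j
      using that index pick entries by simp
    show "poly_eval v (submatrix M R UNIV $$ (i, c)) = 0"
      "poly_eval v (submatrix M R UNIV $$ (i, c')) = 0" if "i < dim_col M" for i
      using that index pick zero c by simp_all
  qed
  then show ?thesis by (auto simp: maximal_minors_def)
qed

section \<open>Tangent dimension and local dimension\<close>

lemma cone_tangent_space_double_zero:
  assumes "I \<subseteq> double_zero_ideal k v"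
  shows "cone_tangent_space k I v = carrier_vec (k + 1)"
  using assms by (auto simp: cone_tangent_space_def double_zero_ideal_def)

text \<open>All gradients vanish at \<open>v\<close>, so the tangent space of the cone is the full
  space of dimension \<open>k + 1\<close>; passing to projective space subtracts 1.\<close>

lemma tangent_dim_double_zero:
  assumes "I \<subseteq> double_zero_ideal k v"
  shows "tangent_dim k I v = ereal (real k)"
proof -
  have "module_vec TYPE(complex) (k + 1)\<lparr>carrier := carrier_vec (k + 1)\<rparr> = module_vec TYPE(complex) (k + 1)"
    by (simp add: module_vec_def)
  then show ?thesis
    by (simp add: tangent_dim_def cone_tangent_space_double_zero[OF assms] vec_space.dim_is_n)
qed

text \<open>A chain through \<open>p\<close> is in particular a chain in \<open>Z\<close>.\<close>

lemma krull_dim_at_le: "krull_dim_at k Z p \<le> krull_dim k Z"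
  unfolding krull_dim_at_def krull_dim_def by (rule Sup_subset_mono) auto


section \<open>The critical matrix on the centers\<close>

lemma row_block_props:
  assumes "r < row_offset h n"
  shows "row_block h r < n" "row_offset h (row_block h r) \<le> r"
    "r - row_offset h (row_block h r) < h (row_block h r) + 1"
proof -
  let ?i = "row_block h r"
  \<comment> \<open>The last block index \<open>m\<close> satisfies the condition under
    \<open>LEAST\<close>, so the minimum exists and is at most \<open>m\<close>.\<close>
  obtain m where m: "n = Suc m"
    using assms by (cases n) (auto simp: row_offset_def)
  have less: "r < row_offset h (Suc ?i)"
    unfolding row_block_def by (rule LeastI[of _ m]) (use assms m in simp)
  have "?i \<le> m"
    unfolding row_block_def by (rule Least_le) (use assms m in simp)
  then show "?i < n" using m by simp
  show le: "row_offset h ?i \<le> r"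
  proof (cases ?i)
    case (Suc j)
    \<comment> \<open>By minimality the preceding block already ends at or before row
      \<open>r\<close>, and its end is the start of block \<open>Suc j\<close>.\<close>
    then have "\<not> r < row_offset h (Suc j)"
      using not_less_Least[of j "\<lambda>i. r < row_offset h (Suc i)"] by (simp add: row_block_def)
    then show ?thesis using Suc by simp
  qed (simp add: row_offset_def)
  show "r - row_offset h ?i < h ?i + 1"
    using less le by (simp add: row_offset_def)
qed

lemma linear_forms_index:
  assumes "Q \<in> carrier_mat m (k + 1)" "s < m"
  shows "linear_forms k Q $ s = (\<Sum>j = 0..<k + 1. Const (Q $$ (s, j)) * Var j)"
  using assms by (auto simp: linear_forms_def scalar_prod_def intro!: sum.cong)

lemma linear_forms_in_coord_polys:
  assumes "Q \<in> carrier_mat m (k + 1)" "s < m"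
  shows "linear_forms k Q $ s \<in> coord_polys k"
  unfolding linear_forms_index[OF assms]
  by (intro coord_polys_sum coord_polys_mult coord_polys_Const coord_polys_Var) auto

lemma poly_eval_linear_forms:
  assumes "Q \<in> carrier_mat m (k + 1)" "s < m" "v \<in> carrier_vec (k + 1)"
  shows "poly_eval v (linear_forms k Q $ s) = (Q *\<^sub>v v) $ s"
proof -
  have "(Q *\<^sub>v v) $ s = (\<Sum>j = 0..<k + 1. Q $$ (s, j) * v $ j)"
    using assms by (simp add: scalar_prod_def del: sum.atLeast0_lessThan_Suc)
  then show ?thesis
    by (simp only: linear_forms_index[OF assms(1,2)] poly_eval_sum poly_eval_mult poly_eval_Const
        poly_eval_Var)
qed

lemma dim_critical_matrix:
  "dim_row (critical_matrix n k h P Q) = row_offset h n"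
  "dim_col (critical_matrix n k h P Q) = n + k + 1"
  by (simp_all add: critical_matrix_def row_offset_def sum_Suc)

lemma critical_matrix_index:
  assumes "r < row_offset h n" "c < n + k + 1"
  shows "critical_matrix n k h P Q $$ (r, c) = (let i = row_block h r; s = r - row_offset h i in
     if c \<le> k then Const (P i $$ (s, c))
     else if c = k + 1 + i then linear_forms k (Q i) $ s else 0)"
proof -
  have "r < n + (\<Sum>i<n. h i)" using assms by (simp add: row_offset_def sum_Suc)
  then show ?thesis using assms by (simp add: critical_matrix_def)
qed

lemma critical_matrix_in_coord_polys:
  assumes "\<And>i. i < n \<Longrightarrow> Q i \<in> carrier_mat (h i + 1) (k + 1)" "r < row_offset h n" "c < n + k + 1"
  shows "critical_matrix n k h P Q $$ (r, c) \<in> coord_polys k"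
  using row_block_props[OF assms(2)]
  by (auto simp: critical_matrix_index[OF assms(2,3)] Let_def coord_polys_Const coord_polys_0
      intro!: linear_forms_in_coord_polys[OF assms(1)])

text \<open>Column \<open>k + 1 + i\<close> is zero outside block \<open>i\<close>; inside it the
  entries are the linear forms of \<open>Q i\<close>, whose values at \<open>v\<close> are the
  coordinates of \<open>Q i *\<^sub>v v\<close>.\<close>

lemma poly_eval_critical_matrix_column:
  assumes "\<And>i. i < n \<Longrightarrow> Q i \<in> carrier_mat (h i + 1) (k + 1)" "r < row_offset h n" "i < n"
    and v: "v \<in> center k (Q i)"
  shows "poly_eval v (critical_matrix n k h P Q $$ (r, k + 1 + i)) = 0"
proof -
  have c: "k + 1 + i < n + k + 1" using assms(3) by simp
  have "poly_eval v (linear_forms k (Q i) $ s) = 0" if "s < h i + 1" for s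
    using poly_eval_linear_forms[OF assms(1)[OF assms(3)] that] v that assms(1)[OF assms(3)]
    by (auto simp: center_def proj_points_def simp del: index_mult_mat_vec)
  then show ?thesis
    using row_block_props[OF assms(2)] unfolding critical_matrix_index[OF assms(2) c]
    by (auto simp: Let_def poly_eval_0)
qed

section \<open>A common point of two centers, by counting rows\<close>

lemma common_kernel_vector:
  fixes A B :: "'a::field mat"
  assumes A: "A \<in> carrier_mat a m" and B: "B \<in> carrier_mat b m" and less: "a + b < m"
  obtains v where "v \<in> carrier_vec m" "v \<noteq> 0\<^sub>v m" "A *\<^sub>v v = 0\<^sub>v a" "B *\<^sub>v v = 0\<^sub>v b"
proof -
  \<comment> \<open>The rows of \<open>A\<close> and \<open>B\<close> are stacked and padded with
    zero rows to a square matrix, so that a zero determinant yields a kernel vector. Row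
    \<open>a + b\<close> exists because \<open>a + b < m\<close>; testing for it first matches the
    shape of \<open>det_row_0\<close>.\<close>
  define C where "C = mat\<^sub>r m m (\<lambda>i. if i = a + b then 0\<^sub>v m else
    if i < a then row A i else if i < a + b then row B (i - a) else 0\<^sub>v m)"
  have C: "C \<in> carrier_mat m m" by (simp add: C_def)
  have "det C = 0"
    unfolding C_def using less A B by (intro det_row_0) auto
  then obtain v where v: "v \<in> carrier_vec m" "v \<noteq> 0\<^sub>v m" "C *\<^sub>v v = 0\<^sub>v m"
    using det_0_iff_vec_prod_zero_field[OF C] by auto
  have row: "row C i \<bullet> v = 0" if "i < m" for i
    using arg_cong[OF v(3), of "\<lambda>u. u $ i"] that C by auto
  have "row C i = row A i" if "i < a" for i
    using that less A by (simp add: C_def)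
  then have "A *\<^sub>v v = 0\<^sub>v a"
    using row less A by (intro eq_vecI) (metis carrier_matD(1) index_mult_mat_vec index_zero_vec
        order.strict_trans trans_less_add1, simp)
  moreover have "row C (a + i) = row B i" if "i < b" for i
    using that less B by (simp add: C_def)
  then have "B *\<^sub>v v = 0\<^sub>v b"
    using row less B by (intro eq_vecI) (auto, metis add_less_cancel_left order.strict_trans)
  ultimately show ?thesis using v that by blast
qed

text \<open>The generated ideal is the least one containing the minors, and these lie in
  \<open>double_zero_ideal k v\<close> since columns \<open>k + 1 + i\<close> and
  \<open>k + 1 + i'\<close> both vanish at \<open>v\<close>.\<close>

lemma critical_ideal_singular_point:
  assumes Q: "\<And>i. i < n \<Longrightarrow> Q i \<in> carrier_mat (h i + 1) (k + 1)"
    and "i < n" "i' < n" "i \<noteq> i'" and "v \<in> center k (Q i)" "v \<in> center k (Q i')"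
  shows "critical_ideal n k h P Q \<subseteq> double_zero_ideal k v"
  unfolding critical_ideal_def
proof (rule ring.genideal_minimal[OF _ ideal_double_zero_ideal])
  show "ring (coord_ring k)"
    using cring_coord_ring by (rule cring.axioms(1))
  show "maximal_minors (critical_matrix n k h P Q) \<subseteq> double_zero_ideal k v"
  proof (rule maximal_minors_double_zero[of _ _ "k + 1 + i" "k + 1 + i'"])
    show "poly_eval v (critical_matrix n k h P Q $$ (r, k + 1 + i)) = 0"
      "poly_eval v (critical_matrix n k h P Q $$ (r, k + 1 + i')) = 0"
      if "r < dim_row (critical_matrix n k h P Q)" for r
      using assms that by (simp_all only: dim_critical_matrix poly_eval_critical_matrix_column)
  qed (use assms in \<open>simp_all add: dim_critical_matrix critical_matrix_in_coord_polys\<close>)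
qed

theorem theorem4p2:
  fixes n k :: nat and h :: "nat \<Rightarrow> nat" and P Q :: "nat \<Rightarrow> complex mat"
  assumes "n \<ge> 5"
    and "\<And>i. i < n \<Longrightarrow> projection k (h i) (P i)"
    and "\<And>i. i < n \<Longrightarrow> projection k (h i) (Q i)"
    and "(\<Inter>i<n. center k (P i)) = {}"
    and "(\<Inter>i<n. center k (Q i)) = {}"
    and "scheme_dim k (critical_ideal n k h P Q) = ereal (2 * real k - (\<Sum>i<n. real (h i)))"
    and "scheme_codim k (critical_ideal n k h P Q) = 1"
  shows "\<not> irreducible_scheme k (critical_ideal n k h P Q) \<or>
         singular_scheme k (critical_ideal n k h P Q)"
proof -
  let ?I = "critical_ideal n k h P Q"
  have h: "1 \<le> h i" if "i < n" for i
    using assms(3)[OF that] by (simp add: projection_def)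
  have Q: "Q i \<in> carrier_mat (h i + 1) (k + 1)" if "i < n" for i
    using assms(3)[OF that] by (simp add: projection_def)
  \<comment> \<open>Codimension 1 turns the expected dimension into
    \<open>k - 1 = 2k - (\<Sum>i<n. h i)\<close>.\<close>
  have "real (\<Sum>i<n. h i) = real (k + 1)"
    using assms(6,7) by (simp add: scheme_codim_def)
  then have sum_h: "(\<Sum>i<n. h i) = k + 1" by (simp only: of_nat_eq_iff)
  have "{..<n} = {0, 1} \<union> {2..<n}" using assms(1) by auto
  then have "(\<Sum>i<n. h i) = h 0 + h 1 + (\<Sum>i = 2..<n. h i)"
    by (simp add: sum.union_disjoint)
  \<comment> \<open>The other \<open>n - 2\<close> blocks contribute at least 3 in total, because
    \<open>n \<ge> 5\<close> and each \<open>h i \<ge> 1\<close>. Thus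
    \<open>h 0 + h 1 \<le> k - 2\<close>, which leaves at most \<open>k\<close> rows for the two
    blocks.\<close>
  moreover have "(\<Sum>i = 2..<n. 1) \<le> (\<Sum>i = 2..<n. h i)"
    using h by (intro sum_mono) auto
  ultimately have rows: "(h 0 + 1) + (h 1 + 1) < k + 1"
    using sum_h assms(1) by simp
  obtain v where v: "v \<in> carrier_vec (k + 1)" "v \<noteq> 0\<^sub>v (k + 1)"
      "Q 0 *\<^sub>v v = 0\<^sub>v (h 0 + 1)" "Q 1 *\<^sub>v v = 0\<^sub>v (h 1 + 1)"
    using assms(1) by (elim common_kernel_vector[OF Q Q rows, rotated 2]) auto
  have "v \<in> center k (Q 0)" "v \<in> center k (Q 1)"
    using v Q[of 0] Q[of 1] assms(1) by (auto simp: center_def proj_points_def)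
  then have sub: "?I \<subseteq> double_zero_ideal k v"
    using assms(1) Q by (intro critical_ideal_singular_point[of _ _ _ _ 0 1]) auto
  have "v \<in> zero_locus k ?I"
    using v sub by (auto simp: zero_locus_def proj_points_def double_zero_ideal_def)
  moreover have "krull_dim_at k (zero_locus k ?I) v < tangent_dim k ?I v"
  proof -
    have "krull_dim_at k (zero_locus k ?I) v \<le> scheme_dim k ?I"
      unfolding scheme_dim_def by (rule krull_dim_at_le)
    \<comment> \<open>Codimension 1 rules out infinite values, so the dimension is the real number
      \<open>k - 1\<close>.\<close>
    also have "\<dots> < ereal (real k)"
      using assms(7) by (cases "scheme_dim k ?I") (auto simp: scheme_codim_def one_ereal_def)
    finally show ?thesis by (simp add: tangent_dim_double_zero[OF sub])
  qed
  ultimately have "singular_scheme k ?I"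
    by (force simp: singular_scheme_def smooth_scheme_def)
  then show ?thesis ..
qed

end
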